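(* Let $t\ge 4$ and $r\ge 3$. There exist a sequence $(G_{t,n})_n$ of graphs, where $G_{t,n}$ is a $K_t$-saturated graph on $n$ vertices, with maximum degree $\Delta(G_{t,n})=\Theta(n)$ as $n\to\infty$, and a constant $n_{r,t}$ such that $$s_r(G_{t,n})<s_r\left(K_{t-2}+\overline{K}_{n-t+2}\right)\quad\text{for all } n\ge n_{r,t}.$$
   Context: All graphs are finite and simple. A graph $G$ is $F$-saturated if it contains no copy of $F$ as a (not necessarily induced) subgraph, but adding any missing edge creates a copy of $F$. $S_r=K_{1,r}$ is the star with $r$ edges, and $s_r(G)$ is the number of copies of $S_r$ in $G$ (as not necessarily induced subgraphs). $G_1+G_2$ denotes the join of $G_1$ and $G_2$ (disjoint union plus all edges between them), and $\overline{K}_m$ is the edgeless graph on $m$ vertices; $K_{t-2}+\overline{K}_{n-t+2}$ is the (complete) split graph. The sequence is indexed by all sufficiently large $n$. *)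

theory Defs
  imports Complex_Main "HOL-Library.Landau_Symbols"
begin

datatype 'a graph = Graph (verts: "'a set") (edges: "'a set set")

definition simple_graph :: "'a graph \<Rightarrow> bool" where
  "simple_graph G \<longleftrightarrow>
     finite (verts G) \<and> (\<forall>e \<in> edges G. e \<subseteq> verts G \<and> card e = 2)"

definition subgraph :: "'a graph \<Rightarrow> 'a graph \<Rightarrow> bool" where
  "subgraph H G \<longleftrightarrow> simple_graph H \<and> verts H \<subseteq> verts G \<and> edges H \<subseteq> edges G"

definition isomorphic :: "'a graph \<Rightarrow> 'b graph \<Rightarrow> bool" where
  "isomorphic G H \<longleftrightarrow>
     (\<exists>f. bij_betw f (verts G) (verts H) \<and> edges H = (\<lambda>e. f ` e) ` edges G)"

(* Copies are unlabelled: they are the subgraphs themselves, not the embeddings of F. *)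
definition copies :: "'a graph \<Rightarrow> 'b graph \<Rightarrow> 'b graph set" where
  "copies F G = {H. subgraph H G \<and> isomorphic F H}"

definition add_edge :: "'a \<Rightarrow> 'a \<Rightarrow> 'a graph \<Rightarrow> 'a graph" where
  "add_edge u v G = Graph (verts G) (insert {u, v} (edges G))"

definition saturated :: "'a graph \<Rightarrow> 'b graph \<Rightarrow> bool" where
  "saturated F G \<longleftrightarrow> simple_graph G \<and> copies F G = {} \<and>
     (\<forall>u \<in> verts G. \<forall>v \<in> verts G.
        u \<noteq> v \<and> {u, v} \<notin> edges G \<longrightarrow> copies F (add_edge u v G) \<noteq> {})"

definition degree :: "'a graph \<Rightarrow> 'a \<Rightarrow> nat" where
  "degree G v = card {e \<in> edges G. v \<in> e}"

(* Only meaningful for a nonempty finite vertex set. *)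
definition max_degree :: "'a graph \<Rightarrow> nat" where
  "max_degree G = Max (degree G ` verts G)"

definition complete_graph :: "nat \<Rightarrow> nat graph" where
  "complete_graph m = Graph {..<m} {e. e \<subseteq> {..<m} \<and> card e = 2}"

definition edgeless_graph :: "nat \<Rightarrow> nat graph" where
  "edgeless_graph m = Graph {..<m} {}"

definition join :: "'a graph \<Rightarrow> 'b graph \<Rightarrow> ('a + 'b) graph" where
  "join G H = Graph (verts G <+> verts H)
     ((\<lambda>e. Inl ` e) ` edges G \<union> (\<lambda>e. Inr ` e) ` edges H \<union>
      {{Inl u, Inr v} | u v. u \<in> verts G \<and> v \<in> verts H})"

definition complete_bipartite :: "nat \<Rightarrow> nat \<Rightarrow> (nat + nat) graph" where
  "complete_bipartite a b = join (edgeless_graph a) (edgeless_graph b)"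

definition star :: "nat \<Rightarrow> (nat + nat) graph" where
  "star r = complete_bipartite 1 r"

definition star_count :: "nat \<Rightarrow> 'a graph \<Rightarrow> nat" where
  "star_count r G = card (copies (star r) G)"

definition split_graph :: "nat \<Rightarrow> nat \<Rightarrow> (nat + nat) graph" where
  "split_graph k m = join (complete_graph k) (edgeless_graph m)"

end

theory Submission
  imports Defs
begin

text \<open>Up to lower order terms, the split graph has \<open>(t - 2) n\<^sup>r / r!\<close> copies of the star: its
  \<open>t - 2\<close> clique vertices have degree \<open>n - 1\<close>, and all other degrees are bounded. The idea is to
  replace two of these hubs by six hubs of degree about \<open>2n/3\<close>, since
  \<open>6 (2/3)\<^sup>r \<le> 16/9 < 2\<close> whenever \<open>r \<ge> 3\<close>.

  The six hubs form a triangular prism: two triangles joined by three disjoint edges, the rungs. All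
  but boundedly many vertices are independent leaves, divided into three classes of nearly equal size,
  one for each rung, and a leaf is joined to the four vertices of the two rungs other than its own.
  Finally \<open>t - 4\<close> vertices are joined to everything. To see why this is \<open>K\<^sub>t\<close>-saturated,
  take \<open>t = 4\<close>.

  \<^item> There is no \<open>K\<^sub>4\<close>: the prism has none, and a leaf sees only a four-cycle of
    the prism, which has no triangle (\<open>prism_graph_no_clique\<close>).

  \<^item> Any two nonadjacent vertices have two adjacent common neighbours, so that the new edge
    completes a \<open>K\<^sub>4\<close> (\<open>prism_graph_common_edge\<close>).

  The comparison rests on the fact that the number of \<open>r\<close>-edge stars is the sum of
  \<open>degree choose r\<close> over all vertices (\<open>star_count_eq_sum_degree\<close>), together with the limit
  computation \<open>eventually_binomial_comparison\<close>.\<close>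

section \<open>Cliques, neighbourhoods and stars\<close>

definition neighbours :: "'a graph \<Rightarrow> 'a \<Rightarrow> 'a set" where
  "neighbours G v = {u. {v, u} \<in> edges G}"

lemma neighbours_subset_verts:
  "simple_graph G \<Longrightarrow> neighbours G v \<subseteq> verts G - {v}"
  unfolding simple_graph_def neighbours_def by fastforce

lemma finite_neighbours: "simple_graph G \<Longrightarrow> finite (neighbours G v)"
  using neighbours_subset_verts[of G v]
  by (meson finite_Diff finite_subset simple_graph_def)

lemma degree_eq_card_neighbours:
  assumes "simple_graph G"
  shows "degree G v = card (neighbours G v)"
proof -
  have "{e \<in> edges G. v \<in> e} = (\<lambda>u. {v, u}) ` neighbours G v"
  proof (intro equalityI subsetI)
    fix e assume e: "e \<in> {e \<in> edges G. v \<in> e}"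
    then have "card e = 2" using assms by (auto simp: simple_graph_def)
    then obtain x y where "e = {x, y}" by (auto simp: card_2_iff)
    with e show "e \<in> (\<lambda>u. {v, u}) ` neighbours G v"
      by (auto simp: neighbours_def insert_commute)
  qed (auto simp: neighbours_def)
  moreover have "inj_on (\<lambda>u. {v, u}) (neighbours G v)"
    by (auto simp: inj_on_def doubleton_eq_iff)
  ultimately show ?thesis by (simp add: degree_def card_image)
qed

definition clique :: "'a graph \<Rightarrow> 'a set \<Rightarrow> bool" where
  "clique G K \<longleftrightarrow> K \<subseteq> verts G \<and> (\<forall>x\<in>K. \<forall>y\<in>K. x \<noteq> y \<longrightarrow> {x, y} \<in> edges G)"

lemma copies_complete_graph_nonempty_iff:
  assumes G: "simple_graph G"
  shows "copies (complete_graph t) G \<noteq> {} \<longleftrightarrow> (\<exists>K. clique G K \<and> card K = t)"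
proof
  assume "copies (complete_graph t) G \<noteq> {}"
  then obtain H f where H: "subgraph H G" and f: "bij_betw f {..<t} (verts H)"
    and e: "edges H = (\<lambda>e. f ` e) ` {e. e \<subseteq> {..<t} \<and> card e = 2}"
    by (auto simp: copies_def isomorphic_def complete_graph_def)
  have "{x, y} \<in> edges G" if xy: "x \<in> verts H" "y \<in> verts H" "x \<noteq> y" for x y
  proof -
    obtain i j where ij: "i < t" "j < t" "x = f i" "y = f j"
      using xy f unfolding bij_betw_def by (metis imageE lessThan_iff)
    then have "{i, j} \<in> {e. e \<subseteq> {..<t} \<and> card e = 2}"
      using xy by (auto simp: card_2_iff)
    then have "f ` {i, j} \<in> edges H" unfolding e by blast
    then show ?thesis using H ij by (auto simp: subgraph_def)
  qed
  then have "clique G (verts H)" using H by (auto simp: clique_def subgraph_def)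
  moreover have "card (verts H) = t" using bij_betw_same_card[OF f] by simp
  ultimately show "\<exists>K. clique G K \<and> card K = t" by blast
next
  assume "\<exists>K. clique G K \<and> card K = t"
  then obtain K where K: "clique G K" "card K = t" by blast
  have fin: "finite K" using K G by (auto simp: clique_def simple_graph_def intro: finite_subset)
  obtain f where f: "bij_betw f {..<t} K"
    using ex_bij_betw_nat_finite[OF fin] K by (auto simp: atLeast0LessThan)
  let ?H = "Graph K {e. e \<subseteq> K \<and> card e = 2}"
  have "{e. e \<subseteq> K \<and> card e = 2} \<subseteq> edges G"
    using K by (auto simp: clique_def card_2_iff)
  then have "subgraph ?H G" using K fin by (auto simp: subgraph_def simple_graph_def clique_def)
  moreover have "{e. e \<subseteq> K \<and> card e = 2} = (\<lambda>e. f ` e) ` {e. e \<subseteq> {..<t} \<and> card e = 2}"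
  proof (intro equalityI subsetI)
    fix e assume "e \<in> {e. e \<subseteq> K \<and> card e = 2}"
    then obtain x y where xy: "e = {x, y}" "x \<noteq> y" "x \<in> K" "y \<in> K" by (auto simp: card_2_iff)
    then obtain i j where "i < t" "j < t" "x = f i" "y = f j"
      using f unfolding bij_betw_def by (metis imageE lessThan_iff)
    with xy show "e \<in> (\<lambda>e. f ` e) ` {e. e \<subseteq> {..<t} \<and> card e = 2}"
      by (intro image_eqI[of _ _ "{i, j}"]) (auto simp: card_2_iff)
  next
    fix e assume "e \<in> (\<lambda>e. f ` e) ` {e. e \<subseteq> {..<t} \<and> card e = 2}"
    then obtain d where d: "e = f ` d" "d \<subseteq> {..<t}" "card d = 2" by auto
    then have "inj_on f d" using f by (auto simp: bij_betw_def intro: inj_on_subset)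
    then show "e \<in> {e. e \<subseteq> K \<and> card e = 2}"
      using d f by (auto simp: bij_betw_def card_image)
  qed
  ultimately have "?H \<in> copies (complete_graph t) G"
    using f by (auto simp: copies_def isomorphic_def complete_graph_def)
  then show "copies (complete_graph t) G \<noteq> {}" by blast
qed

definition star_at :: "'a \<Rightarrow> 'a set \<Rightarrow> 'a graph" where
  "star_at c L = Graph (insert c L) ((\<lambda>l. {c, l}) ` L)"

lemma verts_star: "verts (star r) = insert (Inl 0) (Inr ` {..<r})"
  by (auto simp: star_def complete_bipartite_def join_def edgeless_graph_def)

lemma edges_star: "edges (star r) = (\<lambda>v. {Inl 0, Inr v}) ` {..<r}"
  by (auto simp: star_def complete_bipartite_def join_def edgeless_graph_def)

lemma copies_star_eq:
  assumes G: "simple_graph G"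
  shows "copies (star r) G =
    (\<lambda>(c, L). star_at c L) ` (SIGMA c:verts G. {L. L \<subseteq> neighbours G c \<and> card L = r})"
proof (intro equalityI subsetI)
  fix H assume "H \<in> copies (star r) G"
  then obtain f where H: "subgraph H G" and f: "bij_betw f (verts (star r)) (verts H)"
    and e: "edges H = (\<lambda>e. f ` e) ` edges (star r)"
    by (auto simp: copies_def isomorphic_def)
  define c where "c = f (Inl 0)"
  define L where "L = f ` Inr ` {..<r}"
  have v: "verts H = insert c L"
    using f unfolding bij_betw_def verts_star c_def L_def by auto
  have e': "edges H = (\<lambda>l. {c, l}) ` L"
    unfolding e edges_star c_def L_def by (auto simp: image_image)
  have "inj_on f (Inr ` {..<r})"
    using f unfolding bij_betw_def verts_star by (auto intro: inj_on_subset)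
  then have "card L = r" by (simp add: L_def card_image)
  moreover have "L \<subseteq> neighbours G c" using H e' by (auto simp: neighbours_def subgraph_def)
  moreover have "c \<in> verts G" using H v by (auto simp: subgraph_def)
  moreover have "H = star_at c L" using v e' by (cases H) (simp add: star_at_def)
  ultimately show "H \<in> (\<lambda>(c, L). star_at c L) `
      (SIGMA c:verts G. {L. L \<subseteq> neighbours G c \<and> card L = r})" by auto
next
  fix H assume "H \<in> (\<lambda>(c, L). star_at c L) `
      (SIGMA c:verts G. {L. L \<subseteq> neighbours G c \<and> card L = r})"
  then obtain c L where H: "H = star_at c L" and c: "c \<in> verts G"
    and L: "L \<subseteq> neighbours G c" "card L = r" by auto
  have fin: "finite L" using L finite_neighbours[OF G] by (auto intro: finite_subset)
  have L': "L \<subseteq> verts G" "c \<notin> L" using L neighbours_subset_verts[OF G] by blast+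
  obtain g where g: "bij_betw g {..<r} L"
    using ex_bij_betw_nat_finite[OF fin] L by (auto simp: atLeast0LessThan)
  define f where "f = case_sum (\<lambda>_::nat. c) g"
  have "bij_betw f (verts (star r)) (verts H)"
    using g L' by (auto simp: bij_betw_def verts_star H star_at_def f_def inj_on_def image_image)
  moreover have "edges H = (\<lambda>e. f ` e) ` edges (star r)"
  proof -
    have "L = g ` {..<r}" using g by (simp add: bij_betw_def)
    then show ?thesis by (simp add: H star_at_def edges_star f_def image_image)
  qed
  moreover have "subgraph H G"
    using L L' c fin by (auto simp: subgraph_def simple_graph_def H star_at_def neighbours_def card_2_iff)
  ultimately show "H \<in> copies (star r) G" by (auto simp: copies_def isomorphic_def)
qed

text \<open>For \<open>r = 1\<close> every edge would be counted at both of its ends; from two leaves on, the centre is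
  the only vertex common to all edges of the star, so a copy determines its centre.\<close>

lemma star_count_eq_sum_degree:
  assumes G: "simple_graph G" and r: "r \<ge> 2"
  shows "star_count r G = (\<Sum>v\<in>verts G. degree G v choose r)"
proof -
  let ?S = "SIGMA c:verts G. {L. L \<subseteq> neighbours G c \<and> card L = r}"
  have "inj_on (\<lambda>(c, L). star_at c L) ?S"
  proof (rule inj_onI, clarify)
    fix c L d M
    assume L: "L \<subseteq> neighbours G c" "r = card L" and M: "M \<subseteq> neighbours G d" "card M = card L"
      and eq: "star_at c L = star_at d M"
    have c: "c \<notin> L" and d: "d \<notin> M" using L M neighbours_subset_verts[OF G] by blast+
    have e: "(\<lambda>l. {c, l}) ` L = (\<lambda>l. {d, l}) ` M" and v: "insert c L = insert d M"
      using eq by (auto simp: star_at_def)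
    have "c = d"
    proof (rule ccontr)
      assume "c \<noteq> d"
      have "L \<subseteq> {d}"
      proof
        fix l assume "l \<in> L"
        then have "{c, l} \<in> (\<lambda>l. {d, l}) ` M" using e by blast
        then show "l \<in> {d}" using \<open>c \<noteq> d\<close> by (auto simp: doubleton_eq_iff)
      qed
      then have "card L \<le> 1" using card_mono[of "{d}" L] by simp
      then show False using L r by simp
    qed
    with v c d show "c = d \<and> L = M" by auto
  qed
  then have "star_count r G = card ?S"
    by (simp add: star_count_def copies_star_eq[OF G] card_image)
  also have "\<dots> = (\<Sum>v\<in>verts G. card {L. L \<subseteq> neighbours G v \<and> card L = r})"
    using G finite_neighbours[OF G] by (intro card_SigmaI) (auto simp: simple_graph_def)
  also have "\<dots> = (\<Sum>v\<in>verts G. degree G v choose r)"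
    using finite_neighbours[OF G] by (simp add: n_subsets degree_eq_card_neighbours[OF G])
  finally show ?thesis .
qed

section \<open>The split graph\<close>

lemma simple_split_graph: "simple_graph (split_graph k m)"
proof -
  have "card (Inl ` e :: (nat + nat) set) = card e" for e :: "nat set"
    by (simp add: card_image)
  then show ?thesis
    by (auto simp: simple_graph_def split_graph_def join_def complete_graph_def edgeless_graph_def)
qed

lemma star_count_split_graph_ge:
  assumes "r \<ge> 2"
  shows "k * ((k + m - 1) choose r) \<le> star_count r (split_graph k m)"
proof -
  let ?S = "split_graph k m"
  have V: "verts ?S = {..<k} <+> {..<m}"
    by (simp add: split_graph_def join_def complete_graph_def edgeless_graph_def)
  have deg: "degree ?S (Inl i) = k + m - 1" if "i < k" for i
  proof -
    have 1: "{Inl i, Inl j} \<in> edges ?S" if "j < k" "j \<noteq> i" for j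
    proof -
      have "Inl ` {i, j} \<in> edges ?S"
        using that \<open>i < k\<close> unfolding split_graph_def join_def complete_graph_def
        by (simp only: graph.sel) (rule UnI1, rule UnI1, rule imageI, auto)
      then show ?thesis by simp
    qed
    have 2: "{Inl i, Inr j} \<in> edges ?S" if "j < m" for j
      using that \<open>i < k\<close> by (auto simp: split_graph_def join_def complete_graph_def edgeless_graph_def)
    have "verts ?S - {Inl i} \<subseteq> neighbours ?S (Inl i)"
      using 1 2 by (auto simp: V neighbours_def)
    then have "neighbours ?S (Inl i) = verts ?S - {Inl i}"
      using neighbours_subset_verts[OF simple_split_graph] by blast
    then show ?thesis
      using \<open>i < k\<close>
      by (simp add: degree_eq_card_neighbours[OF simple_split_graph] V card_Plus InlI)
  qed
  have "k * ((k + m - 1) choose r) = (\<Sum>v\<in>Inl ` {..<k}. degree ?S v choose r)"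
    by (simp add: sum.reindex deg)
  also have "\<dots> \<le> (\<Sum>v\<in>verts ?S. degree ?S v choose r)"
    by (rule sum_mono2) (auto simp: V)
  also have "\<dots> = star_count r ?S"
    using star_count_eq_sum_degree[OF simple_split_graph assms] by simp
  finally show ?thesis .
qed

section \<open>The prism graph\<close>

text \<open>The numbers below \<open>6\<close> form the prism: \<open>x mod 3\<close> names the rung of \<open>x\<close> and \<open>x div 3\<close> its
  triangle. The \<open>t - 4\<close> numbers from \<open>6\<close> to \<open>t + 1\<close> are joined to everything, and every
  \<open>v \<ge> t + 2\<close> is a leaf, which misses exactly the rung \<open>v mod 3\<close>.\<close>

definition prism_adj :: "nat \<Rightarrow> nat \<Rightarrow> nat \<Rightarrow> bool" where
  "prism_adj t x y \<longleftrightarrow> x \<noteq> y \<and>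
     (x \<in> {6..<t+2} \<or> y \<in> {6..<t+2} \<or>
      x < 6 \<and> y < 6 \<and> (x mod 3 = y mod 3 \<or> x div 3 = y div 3) \<or>
      x < 6 \<and> t + 2 \<le> y \<and> x mod 3 \<noteq> y mod 3 \<or>
      y < 6 \<and> t + 2 \<le> x \<and> x mod 3 \<noteq> y mod 3)"

definition prism_graph :: "nat \<Rightarrow> nat \<Rightarrow> nat graph" where
  "prism_graph t n = Graph {..<n} {{x, y} | x y. x < n \<and> y < n \<and> prism_adj t x y}"

lemma prism_adj_sym: "prism_adj t x y \<longleftrightarrow> prism_adj t y x"
  unfolding prism_adj_def by metis

lemma verts_prism_graph [simp]: "verts (prism_graph t n) = {..<n}"
  by (simp add: prism_graph_def)

lemma edges_prism_graph_iff:
  "{x, y} \<in> edges (prism_graph t n) \<longleftrightarrow> x < n \<and> y < n \<and> prism_adj t x y"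
  using prism_adj_sym by (auto simp: prism_graph_def doubleton_eq_iff)

lemma simple_prism_graph: "simple_graph (prism_graph t n)"
  by (auto simp: simple_graph_def prism_graph_def prism_adj_def card_2_iff)

lemma neighbours_prism_graph:
  "neighbours (prism_graph t n) x = (if x < n then {y. y < n \<and> prism_adj t x y} else {})"
  by (auto simp: neighbours_def edges_prism_graph_iff)

lemma less_6_cases:
  assumes "(x::nat) < 6"
  obtains "x = 0" | "x = 1" | "x = 2" | "x = 3" | "x = 4" | "x = 5"
  using assms by linarith

lemma mod_3_cases:
  obtains "(x::nat) mod 3 = 0" | "x mod 3 = 1" | "x mod 3 = 2"
  by linarith

lemma prism_colouring:
  fixes x y :: nat
  assumes "x < 6" "y < 6" "x \<noteq> y" "x mod 3 = y mod 3 \<or> x div 3 = y div 3"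
  shows "(x mod 3 + x div 3) mod 3 \<noteq> (y mod 3 + y div 3) mod 3"
  using assms(3,4) by (rule_tac less_6_cases[OF assms(1)]; rule_tac less_6_cases[OF assms(2)]) simp_all

lemma four_cycle_colouring:
  fixes x y v :: nat
  assumes "x < 6" "y < 6" "x \<noteq> y" "x mod 3 = y mod 3 \<or> x div 3 = y div 3"
    and "x mod 3 \<noteq> v mod 3" "y mod 3 \<noteq> v mod 3"
  shows "((x < 3) = (x mod 3 = (v + 1) mod 3)) \<noteq> ((y < 3) = (y mod 3 = (v + 1) mod 3))"
proof -
  have v: "(v + 1) mod 3 = (v mod 3 + 1) mod 3" by (simp add: mod_Suc_eq)
  show ?thesis
    unfolding v using assms(3-6)
    by (rule_tac mod_3_cases[of v]; rule_tac less_6_cases[OF assms(1)];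
        rule_tac less_6_cases[OF assms(2)]) simp_all
qed

text \<open>The vertices of a clique would get distinct colours from a suitable proper colouring with
  \<open>t - 1\<close> colours. No colouring works for all cliques at once, because the leaves would allow only two
  colours on each four-cycle, and no proper colouring of the prism with three colours achieves this on
  all three of them. Without a leaf, the prism is coloured by \<open>0, 1, 2\<close> along one triangle and by
  \<open>1, 2, 0\<close> along the other; if there is a leaf, the four-cycle it sees is coloured alternately by
  \<open>0, 1\<close>, and colour \<open>2\<close> is left for the leaf. The colours from \<open>3\<close> on go to the vertices that
  are joined to everything.\<close>

lemma prism_graph_no_clique:
  assumes t: "t \<ge> 4" and K: "clique (prism_graph t n) K" "card K = t"
  shows False
proof -
  have adj: "prism_adj t x y" if "x \<in> K" "y \<in> K" "x \<noteq> y" for x y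
    using K that by (auto simp: clique_def edges_prism_graph_iff)
  obtain f :: "nat \<Rightarrow> nat" where f: "f ` K \<subseteq> {..<t-1}" "inj_on f K"
  proof (cases "\<exists>v\<in>K. v \<ge> t + 2")
    case False
    define f where "f x = (if x < 6 then (x mod 3 + x div 3) mod 3 else x - 3)" for x :: nat
    have lt: "x < t + 2" if "x \<in> K" for x using False that by force
    have 1: "f x < t - 1" if "x \<in> K" for x
      using lt[OF that] t by (auto simp: f_def intro: less_le_trans[of _ 3])
    have 2: "x = y" if "x \<in> K" "y \<in> K" "f x = f y" for x y
    proof (rule ccontr)
      assume "x \<noteq> y"
      note a = adj[OF that(1,2) this]
      show False
      proof (cases "x < 6 \<and> y < 6")
        case True
        then have "x mod 3 = y mod 3 \<or> x div 3 = y div 3" using a t by (simp add: prism_adj_def)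
        then show False
          using prism_colouring[of x y] True \<open>x \<noteq> y\<close> that(3) by (simp add: f_def)
      next
        case False
        have "f x < 3 \<longleftrightarrow> x < 6" "f y < 3 \<longleftrightarrow> y < 6" by (auto simp: f_def)
        with False that(3) \<open>x \<noteq> y\<close> show False by (auto simp: f_def)
      qed
    qed
    show ?thesis by (rule that[of f]) (use 1 2 in \<open>auto simp: inj_on_def\<close>)
  next
    case True
    then obtain v where v: "v \<in> K" "v \<ge> t + 2" by blast
    define f where "f x = (if x < 6 then (if (x < 3) = (x mod 3 = (v + 1) mod 3) then 0 else 1)
       else if x < t + 2 then x - 3 else 2)" for x :: nat
    have rung: "x mod 3 \<noteq> v mod 3" if "x \<in> K" "x < 6" for x
      using adj[OF that(1) v(1)] that v(2) t by (auto simp: prism_adj_def)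
    have leaf: "x = v" if "x \<in> K" "x \<ge> t + 2" for x
      using adj[OF that(1) v(1)] that v(2) t by (auto simp: prism_adj_def)
    have 1: "f x < t - 1" if "x \<in> K" for x
      using t by (auto simp: f_def)
    have 2: "x = y" if "x \<in> K" "y \<in> K" "f x = f y" for x y
    proof (rule ccontr)
      assume "x \<noteq> y"
      note a = adj[OF that(1,2) this]
      show False
      proof (cases "x < 6 \<and> y < 6")
        case True
        then have "x mod 3 = y mod 3 \<or> x div 3 = y div 3" using a t by (simp add: prism_adj_def)
        moreover have "(x < 3) = (x mod 3 = (v + 1) mod 3) \<longleftrightarrow> (y < 3) = (y mod 3 = (v + 1) mod 3)"
          using True that(3) by (simp add: f_def split: if_splits)
        ultimately show False
          using four_cycle_colouring[of x y v] True \<open>x \<noteq> y\<close> rung[OF that(1)] rung[OF that(2)]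
          by simp
      next
        case False
        have "f x < 2 \<longleftrightarrow> x < 6" "f y < 2 \<longleftrightarrow> y < 6" by (auto simp: f_def)
        moreover have "f x = 2 \<longleftrightarrow> x = v" "f y = 2 \<longleftrightarrow> y = v"
          using leaf[OF that(1)] leaf[OF that(2)] v t by (auto simp: f_def)
        ultimately show False
          using False that(3) \<open>x \<noteq> y\<close> leaf[OF that(1)] leaf[OF that(2)]
          by (auto simp: f_def split: if_splits)
      qed
    qed
    show ?thesis by (rule that[of f]) (use 1 2 in \<open>auto simp: inj_on_def\<close>)
  qed
  then have "card K \<le> t - 1" using card_inj_on_le[of f K "{..<t-1}"] by simp
  then show False using K t by simp
qed

text \<open>Two leaves miss at most two rungs, so they share the third. A leaf and a prism vertex on
  the rung that it misses share the other two vertices of that vertex's triangle. Two nonadjacent prism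
  vertices lie on different rungs and in different triangles: they are opposite in a four-cycle, hence
  share another of its vertices and all leaves that see this cycle. The bound on \<open>n\<close> provides
  such a leaf.\<close>

lemma prism_graph_common_edge:
  assumes t: "t \<ge> 4" and n: "n \<ge> 3 * t + 6"
    and uv: "u < n" "v < n" "u \<noteq> v" "\<not> prism_adj t u v"
  obtains p q where "p < n" "q < n" "p \<notin> {6..<t+2}" "q \<notin> {6..<t+2}" "prism_adj t p q"
    "prism_adj t u p" "prism_adj t u q" "prism_adj t v p" "prism_adj t v q"
proof -
  have not_universal: "u \<notin> {6..<t+2}" "v \<notin> {6..<t+2}" using uv by (auto simp: prism_adj_def)
  note result = that
  have leaf_hub: thesis if xw: "x < 6" "w \<ge> t + 2" "x mod 3 = w mod 3"
    "x = u \<and> w = v \<or> x = v \<and> w = u" for x w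
  proof -
    define p q where "p = (x + 1) mod 3 + 3 * (x div 3)" and "q = (x + 2) mod 3 + 3 * (x div 3)"
    have "p < 6 \<and> q < 6 \<and> prism_adj t p q \<and> prism_adj t x p \<and> prism_adj t x q
        \<and> prism_adj t w p \<and> prism_adj t w q"
      using xw(1)
      by (rule less_6_cases) (use xw(2) xw(3)[symmetric] t in \<open>simp_all add: p_def q_def prism_adj_def\<close>)
    then show thesis using xw(4) n t by (intro result[of p q]) auto
  qed
  obtain j :: nat where j: "j < 3" "j \<noteq> u mod 3" "j \<noteq> v mod 3"
  proof -
    have "\<exists>j<3. j \<noteq> u mod 3 \<and> j \<noteq> v mod 3" by presburger
    then show thesis using that by blast
  qed
  consider "u \<ge> t + 2" "v \<ge> t + 2" | "u < 6" "v \<ge> t + 2" | "u \<ge> t + 2" "v < 6" | "u < 6" "v < 6"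
    using not_universal by fastforce
  then show thesis
  proof cases
    case 1
    then show thesis using 1 j t n by (intro that[of j "j + 3"]) (auto simp: prism_adj_def)
  next
    case 2
    then show thesis using uv by (intro leaf_hub[of u v]) (auto simp: prism_adj_def)
  next
    case 3
    then show thesis using uv by (intro leaf_hub[of v u]) (auto simp: prism_adj_def)
  next
    case 4
    define p where "p = u mod 3 + 3 * (v div 3)"
    \<comment> \<open>The first multiple of \<open>3\<close> that is sure to be a leaf is \<open>3 * (t + 1)\<close>, for every \<open>t\<close>;
        adding \<open>j\<close> selects the class of leaves that misses neither rung.\<close>
    define q where "q = 3 * (t + 1) + j"
    have "q mod 3 = j" unfolding q_def using j by (subst mod_mult_self4) simp
    then have q: "t + 2 \<le> q" "q < n" "q mod 3 \<noteq> u mod 3" "q mod 3 \<noteq> v mod 3"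
      using j n by (auto simp: q_def)
    have ne: "u mod 3 \<noteq> v mod 3" "u div 3 \<noteq> v div 3" using 4 uv by (auto simp: prism_adj_def)
    have "u mod 3 < 3" "v div 3 \<le> 1" using 4(2) by auto
    then have "p < 6" unfolding p_def by linarith
    then have p: "p < 6" "p mod 3 = u mod 3" "p div 3 = v div 3"
      by (auto simp: p_def)
    have "p \<noteq> u" "p \<noteq> v" using p ne by metis+
    have "prism_adj t u p" "prism_adj t v p"
      using p 4 \<open>p \<noteq> u\<close> \<open>p \<noteq> v\<close> by (simp_all add: prism_adj_def)
    moreover have "prism_adj t u q" "prism_adj t v q" "prism_adj t p q"
      using p(1,2) q 4 t by (simp_all add: prism_adj_def)
    ultimately show thesis
      using p(1) q(1,2) t n by (intro that[of p q]) auto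
  qed
qed

lemma saturated_prism_graph:
  assumes t: "t \<ge> 4" and n: "n \<ge> 3 * t + 6"
  shows "saturated (complete_graph t) (prism_graph t n)"
  unfolding saturated_def
proof (intro conjI ballI impI)
  show "simple_graph (prism_graph t n)" by (rule simple_prism_graph)
  show "copies (complete_graph t) (prism_graph t n) = {}"
    using copies_complete_graph_nonempty_iff[OF simple_prism_graph, of t t n]
      prism_graph_no_clique[OF t] by blast
next
  fix u v assume u: "u \<in> verts (prism_graph t n)" and v: "v \<in> verts (prism_graph t n)"
    and uv: "u \<noteq> v \<and> {u, v} \<notin> edges (prism_graph t n)"
  let ?A = "add_edge u v (prism_graph t n)"
  have uv': "u < n" "v < n" "u \<noteq> v" "\<not> prism_adj t u v"
    using u v uv by (auto simp: edges_prism_graph_iff)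
  obtain p q where pq: "p < n" "q < n" "p \<notin> {6..<t+2}" "q \<notin> {6..<t+2}" "prism_adj t p q"
    "prism_adj t u p" "prism_adj t u q" "prism_adj t v p" "prism_adj t v q"
    using prism_graph_common_edge[OF t n uv'] .
  have simp: "simple_graph ?A"
    using simple_prism_graph[of t n] u v uv by (auto simp: simple_graph_def add_edge_def card_2_iff)
  let ?K = "{6..<t+2} \<union> {u, v, p, q}"
  have not_universal: "u \<notin> {6..<t+2}" "v \<notin> {6..<t+2}" using uv' by (auto simp: prism_adj_def)
  have distinct: "u \<noteq> p" "u \<noteq> q" "v \<noteq> p" "v \<noteq> q" "p \<noteq> q" using pq by (auto simp: prism_adj_def)
  have "card ?K = card {6..<t+2} + card {u, v, p, q}"
    using not_universal pq by (intro card_Un_disjoint) auto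
  then have card: "card ?K = t" using distinct uv' t by simp
  have edge: "{x, y} \<in> edges ?A" if "x < n" "y < n" "prism_adj t x y \<or> {x, y} = {u, v}" for x y
    using that by (auto simp: add_edge_def edges_prism_graph_iff)
  have "prism_adj t x y \<or> {x, y} = {u, v}" if "x \<in> ?K" "y \<in> ?K" "x \<noteq> y" for x y
  proof (cases "x \<in> {6..<t+2} \<or> y \<in> {6..<t+2}")
    case True
    then show ?thesis using that(3) by (auto simp: prism_adj_def)
  next
    case False
    then have "x \<in> {u, v, p, q}" "y \<in> {u, v, p, q}" using that by blast+
    then show ?thesis using that(3) pq prism_adj_sym by blast
  qed
  moreover have "x < n" if "x \<in> ?K" for x using that uv' pq n by auto
  ultimately have "clique ?A ?K"
    using edge unfolding clique_def by (auto simp: add_edge_def)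
  with card show "copies (complete_graph t) ?A \<noteq> {}"
    using copies_complete_graph_nonempty_iff[OF simp] by blast
qed

section \<open>Degrees in the prism graph\<close>

lemma card_mod_3_neq:
  assumes "i < 3"
  shows "card {y. y < n \<and> y mod 3 \<noteq> i} \<le> n - n div 3"
proof -
  let ?f = "\<lambda>k. 3 * k + i"
  have "card (?f ` {..<n div 3}) = n div 3" by (simp add: card_image inj_on_def)
  moreover have "?f ` {..<n div 3} \<subseteq> {..<n}" using assms by auto
  ultimately have card: "card ({..<n} - ?f ` {..<n div 3}) = n - n div 3"
    by (subst card_Diff_subset) auto
  have "{y. y < n \<and> y mod 3 \<noteq> i} \<subseteq> {..<n} - ?f ` {..<n div 3}"
    using assms by auto
  then have "card {y. y < n \<and> y mod 3 \<noteq> i} \<le> card ({..<n} - ?f ` {..<n div 3})"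
    by (intro card_mono) auto
  with card show ?thesis by simp
qed

lemma degree_prism_graph_le: "degree (prism_graph t n) x \<le> n - 1"
proof (cases "x < n")
  case True
  have "card (neighbours (prism_graph t n) x) \<le> card ({..<n} - {x})"
    using neighbours_subset_verts[OF simple_prism_graph, of t n x] by (intro card_mono) auto
  then show ?thesis using True by (simp add: degree_eq_card_neighbours[OF simple_prism_graph])
qed (simp add: degree_eq_card_neighbours[OF simple_prism_graph] neighbours_prism_graph)

lemma degree_prism_le:
  assumes "t \<ge> 4" "x < 6"
  shows "degree (prism_graph t n) x \<le> n - n div 3 + (t + 2)"
proof -
  let ?B = "{y. y < n \<and> y mod 3 \<noteq> x mod 3}"
  have "neighbours (prism_graph t n) x \<subseteq> ?B \<union> {..<t+2}"
    using assms by (auto simp: neighbours_prism_graph prism_adj_def split: if_splits)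
  then have "card (neighbours (prism_graph t n) x) \<le> card (?B \<union> {..<t+2})"
    by (intro card_mono) auto
  also have "\<dots> \<le> card ?B + card {..<t+2}" by (rule card_Un_le)
  also have "\<dots> \<le> n - n div 3 + (t + 2)" using card_mod_3_neq[of "x mod 3" n] by simp
  finally show ?thesis by (simp add: degree_eq_card_neighbours[OF simple_prism_graph])
qed

lemma degree_leaf_le:
  assumes "t \<ge> 4" "x \<ge> t + 2"
  shows "degree (prism_graph t n) x \<le> t + 2"
proof -
  have "neighbours (prism_graph t n) x \<subseteq> {..<t+2}"
    using assms by (auto simp: neighbours_prism_graph prism_adj_def)
  then have "card (neighbours (prism_graph t n) x) \<le> card {..<t+2}" by (intro card_mono) auto
  then show ?thesis by (simp add: degree_eq_card_neighbours[OF simple_prism_graph])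
qed

text \<open>For \<open>t = 4\<close> no vertex is joined to everything, so the linear lower bound on the maximum degree
  is taken from a prism vertex: it sees the leaves congruent to \<open>1\<close> modulo \<open>3\<close>.\<close>

lemma degree_prism_0_ge:
  assumes "n > 0"
  shows "n div 3 - (t + 2) \<le> degree (prism_graph t n) 0"
proof -
  have "(\<lambda>k. 3 * k + 1) ` {t+2..<n div 3} \<subseteq> neighbours (prism_graph t n) 0"
  proof -
    have "\<not> 3 dvd Suc (3 * k)" for k :: nat by presburger
    then show ?thesis using assms
      by (auto simp: neighbours_prism_graph prism_adj_def)
  qed
  then have "card ((\<lambda>k. 3 * k + 1) ` {t+2..<n div 3}) \<le> card (neighbours (prism_graph t n) 0)"
    by (intro card_mono finite_neighbours simple_prism_graph)
  then show ?thesis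
    by (simp add: degree_eq_card_neighbours[OF simple_prism_graph] card_image inj_on_def)
qed

lemma max_degree_prism_graph_bigtheta:
  "(\<lambda>n. real (max_degree (prism_graph t n))) \<in> \<Theta>(\<lambda>n. real n)"
proof (rule bigthetaI)
  have "max_degree (prism_graph t n) \<le> n" if "n > 0" for n
    unfolding max_degree_def using that degree_prism_graph_le[of t n]
    by (subst Max_le_iff) (auto intro: order_trans[OF _ diff_le_self])
  then show "(\<lambda>n. real (max_degree (prism_graph t n))) \<in> O(\<lambda>n. real n)"
    by (intro bigoI[where c = 1] eventually_sequentiallyI[of 1]) auto
next
  have "real n \<le> 6 * real (max_degree (prism_graph t n))" if n: "n \<ge> 6 * (t + 3)" for n
  proof -
    have "degree (prism_graph t n) 0 \<le> max_degree (prism_graph t n)"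
      unfolding max_degree_def using n by (intro Max_ge) auto
    with degree_prism_0_ge[of n t] n
    have "n div 3 \<le> max_degree (prism_graph t n) + (t + 2)" by (simp add: le_diff_conv)
    moreover have "n < 3 * (n div 3) + 3" by presburger
    ultimately have "n < 3 * (max_degree (prism_graph t n) + (t + 2)) + 3"
      by (meson add_le_mono1 less_le_trans mult_le_mono2)
    then have "n \<le> 6 * max_degree (prism_graph t n)" using n by simp
    then show ?thesis by linarith
  qed
  then show "(\<lambda>n. real (max_degree (prism_graph t n))) \<in> \<Omega>(\<lambda>n. real n)"
    by (intro landau_omega.bigI[of "1/6"] eventually_sequentiallyI[of "6 * (t + 3)"])
      (auto simp: mult.commute)
qed

section \<open>Comparing the numbers of stars\<close>

lemma star_count_prism_graph_le:
  assumes t: "t \<ge> 4" and n: "n \<ge> t + 2" and r: "r \<ge> 2"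
  shows "star_count r (prism_graph t n) \<le>
    6 * ((n - n div 3 + (t + 2)) choose r) + (t - 4) * ((n - 1) choose r) + n * ((t + 2) choose r)"
proof -
  let ?d = "\<lambda>x. degree (prism_graph t n) x choose r"
  have split: "{..<n} = {..<6} \<union> {6..<t+2} \<union> {t+2..<n}" using t n by auto
  have "star_count r (prism_graph t n) = (\<Sum>x<n. ?d x)"
    using star_count_eq_sum_degree[OF simple_prism_graph r] by simp
  also have "\<dots> = (\<Sum>x<6. ?d x) + (\<Sum>x\<in>{6..<t+2}. ?d x) + (\<Sum>x\<in>{t+2..<n}. ?d x)"
    unfolding split using t by (subst sum.union_disjoint; auto)+
  also have "\<dots> \<le> (\<Sum>x<6::nat. (n - n div 3 + (t + 2)) choose r) + (\<Sum>x\<in>{6..<t+2}. (n - 1) choose r)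
      + (\<Sum>x\<in>{t+2..<n}. (t + 2) choose r)"
    using t by (intro add_mono sum_mono binomial_right_mono degree_prism_le degree_prism_graph_le
        degree_leaf_le) auto
  also have "\<dots> \<le> 6 * ((n - n div 3 + (t + 2)) choose r) + (t - 4) * ((n - 1) choose r)
      + n * ((t + 2) choose r)"
    by simp
  finally show ?thesis .
qed

text \<open>Multiplied by \<open>r! / n\<^sup>r\<close>, the left side tends to \<open>6 (2/3)\<^sup>r < 2\<close> and the right side
  to \<open>2\<close>. The proof needs one-sided estimates only, \<open>r! (d choose r) \<le> d\<^sup>r\<close> and
  \<open>r! ((n - 1) choose r) \<ge> (n - r)\<^sup>r\<close>, and separates the two limits by a number \<open>m\<close>.\<close>

lemma eventually_binomial_comparison:
  fixes c k r :: nat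
  assumes r: "r \<ge> 3"
  shows "\<forall>\<^sub>F n in sequentially.
    6 * ((n - n div 3 + c) choose r) + n * k < 2 * ((n - 1) choose r)"
proof -
  let ?a = "\<lambda>n. 6 * (2/3 + real (c + 1) / real n) ^ r + fact r * real k * (1 / real n) ^ (r - 1)"
  let ?b = "\<lambda>n. 2 * (1 - real r / real n) ^ r"
  have "?a \<longlonglongrightarrow> 6 * (2/3 + 0) ^ r + fact r * real k * 0 ^ (r - 1)"
    by (intro tendsto_intros lim_const_over_n lim_1_over_n)
  then have a: "?a \<longlonglongrightarrow> 6 * (2/3) ^ r" using r by (simp add: power_0_left)
  have "?b \<longlonglongrightarrow> 2 * (1 - 0) ^ r"
    by (intro tendsto_intros lim_const_over_n)
  then have b: "?b \<longlonglongrightarrow> 2" by simp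
  have "(2/3::real) ^ r \<le> (2/3) ^ 3" using r by (intro power_decreasing) auto
  then have "6 * (2/3::real) ^ r < 2" by (simp add: power3_eq_cube)
  then obtain m where m: "6 * (2/3::real) ^ r < m" "m < 2" using dense by blast
  have "\<forall>\<^sub>F n in sequentially. ?a n < m" "\<forall>\<^sub>F n in sequentially. m < ?b n"
    using order_tendstoD(2)[OF a m(1)] order_tendstoD(1)[OF b m(2)] .
  with eventually_ge_at_top[of "r + 1"] show ?thesis
  proof eventually_elim
    case (elim n)
    then have n: "real n > 0" "n \<ge> r + 1" by auto
    let ?d = "n - n div 3 + c"
    have d: "real ?d \<le> real n * (2/3 + real (c + 1) / real n)"
    proof -
      define m where "m = n div 3"
      have "n < 3 * m + 3" "m \<le> n" unfolding m_def by presburger+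
      then have "3 * (n - m + c) \<le> 2 * n + 3 * (c + 1)" by simp
      then have "3 * ?d \<le> 2 * n + 3 * (c + 1)" by (simp only: m_def)
      then have "3 * real ?d \<le> 2 * real n + 3 * real (c + 1)"
        by (metis (mono_tags) of_nat_add of_nat_le_iff of_nat_mult of_nat_numeral)
      then have "real ?d \<le> 2/3 * real n + real (c + 1)" by linarith
      also have "\<dots> = real n * (2/3 + real (c + 1) / real n)"
        using n by (simp add: field_simps)
      finally show ?thesis .
    qed
    have bin: "fact r * real (x choose r) = (\<Prod>i=0..<r. real x - real i)" for x
      by (simp add: binomial_gbinomial gbinomial_prod_rev)
    have up: "fact r * real (?d choose r) \<le> real ?d ^ r"
    proof (cases "r \<le> ?d")
      case True
      then show ?thesis unfolding bin
        using prod_mono[of "{0..<r}" "\<lambda>i. real ?d - real i" "\<lambda>_. real ?d"] by simp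
    qed (simp add: binomial_eq_0)
    have lo: "(real n - real r) ^ r \<le> fact r * real ((n - 1) choose r)"
      unfolding bin
      using prod_mono[of "{0..<r}" "\<lambda>_. real n - real r" "\<lambda>i. real (n - 1) - real i"] n(2)
      by (simp add: of_nat_diff)
    have up': "fact r * real (?d choose r) \<le> (real n * (2/3 + real (c + 1) / real n)) ^ r"
      by (rule order_trans[OF up power_mono[OF d]]) simp
    have "fact r * real (6 * (?d choose r) + n * k)
        = 6 * (fact r * real (?d choose r)) + fact r * real k * real n"
      by (simp add: algebra_simps)
    also have "\<dots> \<le> 6 * (real n * (2/3 + real (c + 1) / real n)) ^ r + fact r * real k * real n"
      by (rule add_right_mono, rule mult_left_mono[OF up']) simp
    also have "\<dots> = real n ^ r * ?a n"
    proof -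
      have "real n ^ r * (1 / real n) ^ (r - 1) = real n"
        using r n by (cases r) (auto simp: power_divide)
      then have "real n ^ r * (fact r * real k * (1 / real n) ^ (r - 1)) = fact r * real k * real n"
        by (metis mult.commute mult.left_commute)
      then show ?thesis
        by (simp only: power_mult_distrib distrib_left[of "real n ^ r"]
            mult.left_commute[of "real n ^ r" 6])
    qed
    also have "\<dots> < real n ^ r * ?b n"
      using elim n by (intro mult_strict_left_mono) auto
    also have "\<dots> = 2 * (real n - real r) ^ r"
    proof -
      have "real n - real r = real n * (1 - real r / real n)" using n by (simp add: field_simps)
      then show ?thesis by (metis power_mult_distrib mult.left_commute)
    qed
    also have "\<dots> \<le> fact r * real (2 * ((n - 1) choose r))"
      using lo by simp
    finally have "real (6 * (?d choose r) + n * k) < real (2 * ((n - 1) choose r))"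
      by (simp only: mult_less_cancel_left_pos fact_gt_zero)
    then show ?case by (simp only: of_nat_less_iff)
  qed
qed

theorem proposition4p2:
  fixes t :: nat
  assumes "t \<ge> 4"
  shows "\<exists>(G :: nat \<Rightarrow> nat graph) n0.
           (\<forall>n \<ge> n0. card (verts (G n)) = n \<and> saturated (complete_graph t) (G n)) \<and>
           (\<lambda>n. real (max_degree (G n))) \<in> \<Theta>(\<lambda>n. real n) \<and>
           (\<forall>r \<ge> 3. \<exists>N. \<forall>n \<ge> N.
              star_count r (G n) < star_count r (split_graph (t - 2) (n - (t - 2))))"
proof (rule exI[of _ "prism_graph t"], rule exI[of _ "3 * t + 6"], intro conjI allI impI)
  show "(\<lambda>n. real (max_degree (prism_graph t n))) \<in> \<Theta>(\<lambda>n. real n)"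
    by (rule max_degree_prism_graph_bigtheta)
next
  fix r :: nat assume r: "r \<ge> 3"
  let ?d = "\<lambda>n. n - n div 3 + (t + 2)"
  obtain N where N: "\<And>n. n \<ge> N \<Longrightarrow>
      6 * (?d n choose r) + n * ((t + 2) choose r) < 2 * ((n - 1) choose r)"
    using eventually_binomial_comparison[OF r, of "t + 2" "(t + 2) choose r"]
    by (auto simp: eventually_sequentially)
  have "star_count r (prism_graph t n) < star_count r (split_graph (t - 2) (n - (t - 2)))"
    if n: "n \<ge> max N (t + 2)" for n
  proof -
    have "star_count r (prism_graph t n)
        \<le> 6 * (?d n choose r) + (t - 4) * ((n - 1) choose r) + n * ((t + 2) choose r)"
      using star_count_prism_graph_le[of t n r] assms n r by simp
    also have "\<dots> < 2 * ((n - 1) choose r) + (t - 4) * ((n - 1) choose r)"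
      using N[of n] n by simp
    also have "\<dots> = (t - 2) * ((n - 1) choose r)"
    proof -
      have "t - 2 = 2 + (t - 4)" using assms by simp
      then show ?thesis by (simp only: distrib_right)
    qed
    also have "\<dots> \<le> star_count r (split_graph (t - 2) (n - (t - 2)))"
      using star_count_split_graph_ge[of r "t - 2" "n - (t - 2)"] n r by simp
    finally show ?thesis .
  qed
  then show "\<exists>N. \<forall>n\<ge>N. star_count r (prism_graph t n)
      < star_count r (split_graph (t - 2) (n - (t - 2)))" by blast
qed (use assms saturated_prism_graph in simp_all)

end
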